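(* Let $S:\operatorname{dom} S\subseteq \ell^2\to\ell^2$ be the linear operator with $$\operatorname{dom} S=\Big\{y=(y_n)_{n\ge 1}\in\ell^2 \;\Big|\; \sum_{i\ge 1}y_i=0,\ \Big(\sum_{i\le n}y_i\Big)_{n\ge 1}\in\ell^2\Big\},\qquad Sy=\Big(\sum_{i<n}y_i+\tfrac12 y_n\Big)_{n\ge 1}\quad (y\in\operatorname{dom} S).$$ Then $S$ is a maximal monotone operator. In particular, $\operatorname{gra}S$ is closed.
   Context: $\ell^2$ is the real Hilbert space of square-summable real sequences $(x_1,x_2,\dots)$ with inner product $\langle\cdot,\cdot\rangle$. Infinite series are limits of partial sums, and $\sum_{i<1}y_i=0$. For a set-valued operator $A:X\rightrightarrows X$ on a real Hilbert space $X$, $\operatorname{gra}A=\{(x,x^* )\in X\times X\mid x^*\in Ax\}$. A linear single-valued operator with domain $\operatorname{dom}S$ is identified with the at most single-valued set-valued operator having the same graph. $A$ is monotone if $\langle x-y,x^*-y^*\rangle\ge 0$ for all $(x,x^* ),(y,y^* )\in\operatorname{gra}A$, and maximal monotone if it is monotone and no proper enlargement (in the sense of graph inclusion) of $A$ is monotone. *)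

theory Defs
  imports "HOL-Analysis.Analysis"
begin

section \<open>The real Hilbert space of square-summable sequences\<close>

text \<open>Sequences are indexed from 0: the entry at index \<open>n\<close> is the entry usually written with
  subscript \<open>n + 1\<close>. A sum over \<open>i \<le> n\<close>, or over \<open>i < n\<close>, keeps its form under this shift.\<close>

definition square_summable :: "(nat \<Rightarrow> real) \<Rightarrow> bool" where
  "square_summable x \<longleftrightarrow> summable (\<lambda>n. (x n)\<^sup>2)"

lemma square_summable_zero: "square_summable (\<lambda>_. 0)"
  by (simp add: square_summable_def)

lemma square_summable_scale:
  assumes "square_summable x"
  shows "square_summable (\<lambda>n. c * x n)"
  using assms summable_mult[of "\<lambda>n. (x n)\<^sup>2" "c\<^sup>2"]
  by (simp add: square_summable_def power_mult_distrib)

lemma square_summable_add: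
  assumes "square_summable x" "square_summable y"
  shows "square_summable (\<lambda>n. x n + y n)"
  unfolding square_summable_def
proof (rule summable_comparison_test')
  show "summable (\<lambda>n. 2 * (x n)\<^sup>2 + 2 * (y n)\<^sup>2)"
    using assms by (intro summable_add summable_mult) (auto simp: square_summable_def)
  show "norm ((x n + y n)\<^sup>2) \<le> 2 * (x n)\<^sup>2 + 2 * (y n)\<^sup>2" if "n \<ge> 0" for n
    unfolding real_norm_def abs_power2
    using zero_le_power2[of "x n - y n"] unfolding power2_sum power2_diff by linarith
qed

lemma square_summable_diff:
  assumes "square_summable x" "square_summable y"
  shows "square_summable (\<lambda>n. x n - y n)"
  using square_summable_add[OF assms(1) square_summable_scale[OF assms(2), of "-1"]] by simp

lemma summable_mult_square_summable:
  assumes "square_summable x" "square_summable y"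
  shows "summable (\<lambda>n. x n * y n)"
proof (rule summable_comparison_test')
  show "summable (\<lambda>n. (x n)\<^sup>2 + (y n)\<^sup>2)"
    using assms by (intro summable_add) (auto simp: square_summable_def)
  show "norm (x n * y n) \<le> (x n)\<^sup>2 + (y n)\<^sup>2" if "n \<ge> 0" for n
  proof -
    have "2 * (\<bar>x n\<bar> * \<bar>y n\<bar>) \<le> (x n)\<^sup>2 + (y n)\<^sup>2"
      using zero_le_power2[of "\<bar>x n\<bar> - \<bar>y n\<bar>"] by (simp add: power2_diff)
    moreover have "0 \<le> \<bar>x n\<bar> * \<bar>y n\<bar>" by simp
    ultimately show ?thesis unfolding real_norm_def abs_mult by linarith
  qed
qed

typedef ell2 = "{x. square_summable x}"
  morphisms ell2_nth Abs_ell2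
  using square_summable_zero by blast

setup_lifting type_definition_ell2

lemma square_summable_nth: "square_summable (ell2_nth x)"
  using ell2_nth[of x] by simp

lemma ell2_eqI: "(\<And>n. ell2_nth x n = ell2_nth y n) \<Longrightarrow> x = y"
  by (simp add: ell2_nth_inject[symmetric] ext)

instantiation ell2 :: real_vector
begin

lift_definition zero_ell2 :: ell2 is "\<lambda>_. 0"
  by (rule square_summable_zero)

lift_definition plus_ell2 :: "ell2 \<Rightarrow> ell2 \<Rightarrow> ell2" is "\<lambda>x y n. x n + y n"
  by (rule square_summable_add)

lift_definition minus_ell2 :: "ell2 \<Rightarrow> ell2 \<Rightarrow> ell2" is "\<lambda>x y n. x n - y n"
  by (rule square_summable_diff)

lift_definition uminus_ell2 :: "ell2 \<Rightarrow> ell2" is "\<lambda>x n. - x n"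
  using square_summable_scale[of _ "-1"] by simp

lift_definition scaleR_ell2 :: "real \<Rightarrow> ell2 \<Rightarrow> ell2" is "\<lambda>c x n. c * x n"
  by (rule square_summable_scale)

instance
  by standard (transfer; simp add: algebra_simps)+

end

lemma nth_zero [simp]: "ell2_nth 0 n = 0"
  by transfer simp
lemma nth_add [simp]: "ell2_nth (x + y) n = ell2_nth x n + ell2_nth y n"
  by transfer simp
lemma nth_diff [simp]: "ell2_nth (x - y) n = ell2_nth x n - ell2_nth y n"
  by transfer simp
lemma nth_uminus [simp]: "ell2_nth (- x) n = - ell2_nth x n"
  by transfer simp
lemma nth_scaleR [simp]: "ell2_nth (c *\<^sub>R x) n = c * ell2_nth x n"
  by transfer simp

instantiation ell2 :: real_inner
begin

definition inner_ell2 :: "ell2 \<Rightarrow> ell2 \<Rightarrow> real" where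
  "inner_ell2 x y = (\<Sum>n. ell2_nth x n * ell2_nth y n)"

definition norm_ell2 :: "ell2 \<Rightarrow> real" where
  "norm_ell2 x = sqrt (inner x x)"

definition dist_ell2 :: "ell2 \<Rightarrow> ell2 \<Rightarrow> real" where
  "dist_ell2 x y = norm (x - y)"

definition sgn_ell2 :: "ell2 \<Rightarrow> ell2" where
  "sgn_ell2 x = x /\<^sub>R norm x"

definition uniformity_ell2 :: "(ell2 \<times> ell2) filter" where
  "uniformity_ell2 = (INF e\<in>{0<..}. principal {(x, y). dist x y < e})"

definition open_ell2 :: "ell2 set \<Rightarrow> bool" where
  "open_ell2 U \<longleftrightarrow> (\<forall>x\<in>U. eventually (\<lambda>(x', y). x' = x \<longrightarrow> y \<in> U) uniformity)"

instance
proof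
  fix x y z :: ell2 and r :: real
  have smm: "summable (\<lambda>n. ell2_nth u n * ell2_nth v n)" for u v
    by (intro summable_mult_square_summable square_summable_nth)
  show "dist x y = norm (x - y)" by (rule dist_ell2_def)
  show "sgn x = x /\<^sub>R norm x" by (rule sgn_ell2_def)
  show "(uniformity :: (ell2 \<times> ell2) filter) = (INF e\<in>{0<..}. principal {(x, y). dist x y < e})"
    by (rule uniformity_ell2_def)
  show "open U \<longleftrightarrow> (\<forall>x\<in>U. eventually (\<lambda>(x', y). x' = x \<longrightarrow> y \<in> U) uniformity)"
    for U :: "ell2 set" by (rule open_ell2_def)
  show "inner x y = inner y x" by (simp add: inner_ell2_def mult.commute)
  show "inner (x + y) z = inner x z + inner y z"
    by (simp add: inner_ell2_def distrib_right suminf_add[OF smm smm])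
  show "inner (r *\<^sub>R x) y = r * inner x y"
    by (simp add: inner_ell2_def mult.assoc suminf_mult[OF smm])
  show "0 \<le> inner x x"
    unfolding inner_ell2_def by (rule suminf_nonneg[OF smm]) simp
  show "inner x x = 0 \<longleftrightarrow> x = 0"
  proof
    assume "inner x x = 0"
    then have "\<forall>n. ell2_nth x n * ell2_nth x n = 0"
      using suminf_eq_zero_iff[OF smm[of x x]] by (simp add: inner_ell2_def)
    then show "x = 0" by (intro ell2_eqI) simp
  qed (simp add: inner_ell2_def)
  show "norm x = sqrt (inner x x)" by (rule norm_ell2_def)
qed

end

lemma power2_norm_ell2: "(norm x)\<^sup>2 = (\<Sum>n. (ell2_nth x n)\<^sup>2)"
  unfolding power2_norm_eq_inner inner_ell2_def by (simp only: power2_eq_square)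

lemma sum_squares_le_norm: "(\<Sum>n<k. (ell2_nth x n)\<^sup>2) \<le> (norm x)\<^sup>2"
proof -
  have "(\<Sum>n<k. (ell2_nth x n)\<^sup>2) \<le> (\<Sum>n. (ell2_nth x n)\<^sup>2)"
    using square_summable_nth[of x] by (intro sum_le_suminf) (auto simp: square_summable_def)
  then show ?thesis
    by (simp only: power2_norm_ell2)
qed

lemma abs_nth_le_norm: "\<bar>ell2_nth x n\<bar> \<le> norm x"
proof -
  have "(ell2_nth x n)\<^sup>2 \<le> (\<Sum>i<Suc n. (ell2_nth x i)\<^sup>2)"
    by (simp add: sum_nonneg)
  also note sum_squares_le_norm
  finally show ?thesis
    using power2_le_imp_le[of "\<bar>ell2_nth x n\<bar>" "norm x"] by simp
qed

instance ell2 :: complete_space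
proof
  fix X :: "nat \<Rightarrow> ell2"
  assume X: "Cauchy X"
  have "convergent (\<lambda>m. ell2_nth (X m) n)" for n
  proof (rule Cauchy_convergent, rule metric_CauchyI)
    fix e :: real assume "e > 0"
    then obtain N where N: "\<forall>m\<ge>N. \<forall>k\<ge>N. dist (X m) (X k) < e"
      using metric_CauchyD[OF X] by blast
    have "dist (ell2_nth (X m) n) (ell2_nth (X k) n) \<le> dist (X m) (X k)" for m k
      using abs_nth_le_norm[of "X m - X k" n] by (simp add: dist_norm)
    then show "\<exists>M. \<forall>m\<ge>M. \<forall>k\<ge>M. dist (ell2_nth (X m) n) (ell2_nth (X k) n) < e"
      using N by (meson le_less_trans)
  qed
  then obtain a where a: "\<And>n. (\<lambda>m. ell2_nth (X m) n) \<longlonglongrightarrow> a n"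
    unfolding convergent_def by metis
  have bound: "\<exists>N. \<forall>m\<ge>N. \<forall>K. (\<Sum>n<K. (ell2_nth (X m) n - a n)\<^sup>2) \<le> e\<^sup>2" if e: "e > 0" for e
  proof -
    obtain N where N: "\<And>m k. m \<ge> N \<Longrightarrow> k \<ge> N \<Longrightarrow> dist (X m) (X k) < e"
      using metric_CauchyD[OF X e] by blast
    have "(\<Sum>n<K. (ell2_nth (X m) n - a n)\<^sup>2) \<le> e\<^sup>2" if m: "m \<ge> N" for m K
    proof (rule LIMSEQ_le_const2)
      show "(\<lambda>k. \<Sum>n<K. (ell2_nth (X m) n - ell2_nth (X k) n)\<^sup>2)
              \<longlonglongrightarrow> (\<Sum>n<K. (ell2_nth (X m) n - a n)\<^sup>2)"
        by (intro tendsto_intros a)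
      have "(\<Sum>n<K. (ell2_nth (X m) n - ell2_nth (X k) n)\<^sup>2) \<le> e\<^sup>2" if "k \<ge> N" for k
      proof -
        have "(norm (X m - X k))\<^sup>2 \<le> e\<^sup>2"
          using N[OF m that] by (intro power_mono) (auto simp: dist_norm)
        then show ?thesis using sum_squares_le_norm[of "X m - X k" K] by simp
      qed
      then show "\<exists>N. \<forall>k\<ge>N. (\<Sum>n<K. (ell2_nth (X m) n - ell2_nth (X k) n)\<^sup>2) \<le> e\<^sup>2"
        by blast
    qed
    then show ?thesis by blast
  qed
  have summ: "summable f" if "\<And>n. f n \<ge> 0" "\<And>K. sum f {..<K} \<le> B" for f :: "nat \<Rightarrow> real" and B
  proof (rule bounded_imp_summable)
    show "sum f {..K} \<le> B" for K using that(2)[of "Suc K"] by (simp add: lessThan_Suc_atMost)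
  qed (rule that(1))
  obtain M where "\<forall>K. (\<Sum>n<K. (ell2_nth (X M) n - a n)\<^sup>2) \<le> 1\<^sup>2"
    using bound[of 1] by auto
  then have "square_summable (\<lambda>n. ell2_nth (X M) n - a n)"
    unfolding square_summable_def by (intro summ[where B = "1\<^sup>2"]) auto
  from square_summable_diff[OF square_summable_nth[of "X M"] this]
  have "square_summable a" by simp
  then have L: "ell2_nth (Abs_ell2 a) = a" by (simp add: Abs_ell2_inverse)
  have "X \<longlonglongrightarrow> Abs_ell2 a"
  proof (rule metric_LIMSEQ_I)
    fix e :: real assume e: "e > 0"
    obtain N where N: "\<And>m K. m \<ge> N \<Longrightarrow> (\<Sum>n<K. (ell2_nth (X m) n - a n)\<^sup>2) \<le> (e / 2)\<^sup>2"
      using bound[of "e / 2"] e by auto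
    have "dist (X m) (Abs_ell2 a) < e" if m: "m \<ge> N" for m
    proof -
      have "(norm (X m - Abs_ell2 a))\<^sup>2 = (\<Sum>n. (ell2_nth (X m) n - a n)\<^sup>2)"
        by (simp add: power2_norm_ell2 L)
      also have "\<dots> \<le> (e / 2)\<^sup>2"
        using square_summable_nth[of "X m - Abs_ell2 a"] N[OF m]
        by (intro suminf_le_const) (auto simp: square_summable_def L)
      finally have "norm (X m - Abs_ell2 a) \<le> e / 2"
        by (rule power2_le_imp_le) (use e in simp)
      then show ?thesis using e by (simp add: dist_norm)
    qed
    then show "\<exists>N. \<forall>m\<ge>N. dist (X m) (Abs_ell2 a) < e" by blast
  qed
  then show "convergent X" by (auto simp: convergent_def)
qed


section \<open>Set-valued operators\<close>

definition gra :: "('a \<Rightarrow> 'a set) \<Rightarrow> ('a \<times> 'a) set" where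
  "gra A = {(x, x'). x' \<in> A x}"

definition monotone_op :: "('a::real_inner \<Rightarrow> 'a set) \<Rightarrow> bool" where
  "monotone_op A \<longleftrightarrow>
     (\<forall>(x, x') \<in> gra A. \<forall>(y, y') \<in> gra A. inner (x - y) (x' - y') \<ge> 0)"

definition maximal_monotone_op :: "('a::{real_inner, complete_space} \<Rightarrow> 'a set) \<Rightarrow> bool" where
  "maximal_monotone_op A \<longleftrightarrow>
     monotone_op A \<and> \<not> (\<exists>B. monotone_op B \<and> gra A \<subset> gra B)"

definition set_valued_on :: "'a set \<Rightarrow> ('a \<Rightarrow> 'a) \<Rightarrow> 'a \<Rightarrow> 'a set" where
  "set_valued_on D T = (\<lambda>x. if x \<in> D then {T x} else {})"


section \<open>The operator\<close>

definition dom_S :: "ell2 set" where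
  "dom_S = {y. (\<lambda>i. ell2_nth y i) sums 0 \<and> square_summable (\<lambda>n. \<Sum>i\<le>n. ell2_nth y i)}"

text \<open>Only the values on \<open>dom_S\<close> are meaningful, where the sequence on the right is
  square-summable (lemma \<open>nth_S_fun\<close>).\<close>

definition S_fun :: "ell2 \<Rightarrow> ell2" where
  "S_fun y = Abs_ell2 (\<lambda>n. (\<Sum>i<n. ell2_nth y i) + 1 / 2 * ell2_nth y n)"

definition S_op :: "ell2 \<Rightarrow> ell2 set" where
  "S_op = set_valued_on dom_S S_fun"

lemma nth_S_fun:
  assumes "y \<in> dom_S"
  shows "ell2_nth (S_fun y) n = (\<Sum>i<n. ell2_nth y i) + 1 / 2 * ell2_nth y n"
proof -
  have "summable (\<lambda>n. (\<Sum>i<Suc n. ell2_nth y i)\<^sup>2)"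
    using assms by (simp add: dom_S_def square_summable_def lessThan_Suc_atMost del: sum.lessThan_Suc)
  then have "square_summable (\<lambda>n. \<Sum>i<n. ell2_nth y i)"
    unfolding square_summable_def by (subst (asm) summable_Suc_iff)
  then have "square_summable (\<lambda>n. (\<Sum>i<n. ell2_nth y i) + 1 / 2 * ell2_nth y n)"
    by (intro square_summable_add square_summable_scale square_summable_nth)
  then show ?thesis by (simp add: S_fun_def Abs_ell2_inverse)
qed

lemma subspace_dom_S: "subspace dom_S"
proof (rule subspaceI)
  have "ell2_nth 0 = (\<lambda>_. 0)" by (rule ext) simp
  then show "0 \<in> dom_S" by (simp add: dom_S_def square_summable_zero)
  show "x + y \<in> dom_S" if "x \<in> dom_S" "y \<in> dom_S" for x y
  proof -
    have "ell2_nth (x + y) = (\<lambda>n. ell2_nth x n + ell2_nth y n)" by (rule ext) simp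
    then show ?thesis
      using that sums_add[of "ell2_nth x" 0 "ell2_nth y" 0]
      by (simp add: dom_S_def sum.distrib square_summable_add)
  qed
  show "c *\<^sub>R x \<in> dom_S" if "x \<in> dom_S" for c x
  proof -
    have "ell2_nth (c *\<^sub>R x) = (\<lambda>n. c * ell2_nth x n)" by (rule ext) simp
    then show ?thesis
      using that sums_mult[of "ell2_nth x" 0 c]
      by (simp add: dom_S_def sum_distrib_left[symmetric] square_summable_scale)
  qed
qed

lemma S_fun_add:
  assumes "x \<in> dom_S" "y \<in> dom_S"
  shows "S_fun (x + y) = S_fun x + S_fun y"
  using assms subspace_add[OF subspace_dom_S assms]
  by (intro ell2_eqI) (simp add: nth_S_fun sum.distrib algebra_simps)

lemma S_fun_scaleR:
  assumes "x \<in> dom_S"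
  shows "S_fun (c *\<^sub>R x) = c *\<^sub>R S_fun x"
  using assms subspace_scale[OF subspace_dom_S assms]
  by (intro ell2_eqI) (simp add: nth_S_fun sum_distrib_left[symmetric] algebra_simps)

end

theory Submission
  imports Defs
begin

text \<open>
  Everything rests on one telescoping identity. If \<open>p\<close> is a null sequence, then the sequence of
  differences \<open>p (n + 1) - p n\<close> pairs with the sequence of midpoints \<open>(p n + p (n + 1)) / 2\<close> to
  \<open>- (p 0)\<^sup>2 / 2\<close>, because each product is half a difference of consecutive squares
  (\<open>inner_differences_midpoints\<close>).

  For \<open>y\<close> in the domain, take \<open>p\<close> to be the partial sums of \<open>y\<close>: the differences are \<open>y\<close>, the
  midpoints are \<open>S y\<close>, and \<open>p 0 = 0\<close>. Hence \<open>\<langle>y, S y\<rangle> = 0\<close>, and the linear operator \<open>S\<close> is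
  monotone.

  For maximality, let \<open>(x, x')\<close> be monotonically related to the whole graph of \<open>S\<close>. As the graph is
  a subspace on which the quadratic form \<open>\<langle>y, S y\<rangle>\<close> vanishes, \<open>\<langle>x - t y, x' - t S y\<rangle>\<close> is affine
  in \<open>t\<close> and bounded below, so \<open>\<langle>y, x'\<rangle> + \<langle>x, S y\<rangle> = 0\<close> for every \<open>y\<close> in the domain
  (\<open>skew_adjoint_relation\<close>). Testing this with differences of consecutive unit vectors determines
  \<open>x'\<close> up to a constant \<open>c\<close>: the square-summable sequence \<open>p = x' - x / 2\<close> equals
  \<open>c\<close> plus the partial sums of \<open>x\<close>. The differences of \<open>p\<close> are \<open>x\<close> and its midpoints are \<open>x'\<close>, so
  \<open>\<langle>x, x'\<rangle> = - c\<^sup>2 / 2\<close>. Monotonicity against the origin gives \<open>\<langle>x, x'\<rangle> \<ge> 0\<close>, hence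
  \<open>c = 0\<close>, and that says precisely that \<open>x\<close> is in the domain and \<open>x' = S x\<close>.

  Closedness holds for every maximal monotone operator (\<open>closed_gra_maximal_monotone_op\<close>).
\<close>

section \<open>Monotonically related points\<close>

definition monotonically_related :: "('a::real_inner \<Rightarrow> 'a set) \<Rightarrow> 'a \<Rightarrow> 'a \<Rightarrow> bool" where
  "monotonically_related A x x' \<longleftrightarrow> (\<forall>(y, y') \<in> gra A. inner (x - y) (x' - y') \<ge> 0)"

lemma monotonically_relatedD:
  "monotonically_related A x x' \<Longrightarrow> (y, y') \<in> gra A \<Longrightarrow> inner (x - y) (x' - y') \<ge> 0"
  by (auto simp: monotonically_related_def)

lemma monotone_op_iff_related:
  "monotone_op A \<longleftrightarrow> (\<forall>(x, x') \<in> gra A. monotonically_related A x x')"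
  by (auto simp: monotone_op_def monotonically_related_def)

text \<open>A point related to the graph can be adjoined to it without losing monotonicity; conversely,
  any monotone enlargement consists of related points.\<close>

lemma maximal_monotone_op_iff_related:
  "maximal_monotone_op A \<longleftrightarrow> (\<forall>x x'. (x, x') \<in> gra A \<longleftrightarrow> monotonically_related A x x')"
    (is "_ \<longleftrightarrow> ?R")
proof
  assume max: "maximal_monotone_op A"
  then have mono: "monotone_op A" by (simp add: maximal_monotone_op_def)
  have "(x, x') \<in> gra A" if rel: "monotonically_related A x x'" for x x'
  proof (rule ccontr)
    assume new: "(x, x') \<notin> gra A"
    define B where "B = (\<lambda>z. {w. (z, w) \<in> insert (x, x') (gra A)})"
    have gra_B: "gra B = insert (x, x') (gra A)"
      by (auto simp: gra_def B_def)
    have flip: "inner (y - x) (y' - x') \<ge> 0" if "(y, y') \<in> gra A" for y y'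
      using monotonically_relatedD[OF rel that]
      by (metis inner_minus_left inner_minus_right minus_diff_eq minus_minus)
    have "monotone_op B"
      unfolding monotone_op_def gra_B
      using mono monotonically_relatedD[OF rel] flip
      by (auto simp: monotone_op_def)
    moreover have "gra A \<subset> gra B" using new gra_B by auto
    ultimately show False using max by (auto simp: maximal_monotone_op_def)
  qed
  then show ?R using mono by (auto simp: monotone_op_iff_related)
next
  assume R: ?R
  have "gra B \<subseteq> gra A" if mono: "monotone_op B" and sub: "gra A \<subseteq> gra B" for B
  proof
    fix u assume "u \<in> gra B"
    then have "monotonically_related A (fst u) (snd u)"
      using mono sub unfolding monotone_op_def monotonically_related_def by fastforce
    then show "u \<in> gra A" using R by (metis prod.collapse)
  qed
  moreover have "monotone_op A"
    using R by (auto simp: monotone_op_iff_related)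
  ultimately show "maximal_monotone_op A"
    unfolding maximal_monotone_op_def by blast
qed

text \<open>The graph of a maximal monotone operator is cut out by the non-strict inequalities that
  express being related to its points, and each of them defines a closed set.\<close>

lemma closed_gra_maximal_monotone_op:
  assumes "maximal_monotone_op A"
  shows "closed (gra A)"
proof -
  have "p \<in> gra A \<longleftrightarrow> (\<forall>q\<in>gra A. 0 \<le> inner (fst p - fst q) (snd p - snd q))" for p
    using assms
    by (cases p)
       (simp add: maximal_monotone_op_iff_related monotonically_related_def case_prod_beta)
  then have "gra A = (\<Inter>q\<in>gra A. {p. 0 \<le> inner (fst p - fst q) (snd p - snd q)})"
    by blast
  moreover have "closed (\<Inter>q\<in>gra A. {p. 0 \<le> inner (fst p - fst q) (snd p - snd q)})"
    by (intro closed_INT ballI closed_Collect_le continuous_intros)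
  ultimately show ?thesis by simp
qed

text \<open>The inequality for the multiple \<open>t y\<close> is affine in \<open>t\<close> since its quadratic term
  vanishes, and an affine function that is nonnegative on the whole line has slope zero.\<close>

lemma skew_adjoint_relation:
  assumes related: "\<And>t::real. inner (x - t *\<^sub>R y) (x' - t *\<^sub>R y') \<ge> 0"
    and skew: "inner y y' = 0"
  shows "inner y x' + inner x y' = 0"
proof (rule ccontr)
  let ?b = "inner y x' + inner x y'"
  assume b: "?b \<noteq> 0"
  have "inner (x - t *\<^sub>R y) (x' - t *\<^sub>R y') = inner x x' - t * ?b" for t
    by (simp add: inner_diff_left inner_diff_right skew algebra_simps)
  from related[of "(inner x x' + 1) / ?b", unfolded this]
  show False using b by simp
qed

section \<open>The telescoping identity\<close>

lemma inner_differences_midpoints: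
  assumes "p \<longlonglongrightarrow> (0::real)"
    and "\<And>n. ell2_nth u n = p (Suc n) - p n"
    and "\<And>n. ell2_nth v n = (p n + p (Suc n)) / 2"
  shows "inner u v = - (p 0)\<^sup>2 / 2"
proof -
  have "(\<lambda>n. (p n)\<^sup>2 / 2) \<longlonglongrightarrow> 0\<^sup>2 / 2"
    by (intro tendsto_intros assms(1)) simp
  then have "(\<lambda>n. (p (Suc n))\<^sup>2 / 2 - (p n)\<^sup>2 / 2) sums (0\<^sup>2 / 2 - (p 0)\<^sup>2 / 2)"
    by (rule telescope_sums)
  moreover have "ell2_nth u n * ell2_nth v n = (p (Suc n))\<^sup>2 / 2 - (p n)\<^sup>2 / 2" for n
    by (simp add: assms(2,3) power2_eq_square field_simps)
  ultimately show ?thesis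
    by (simp add: inner_ell2_def sums_iff)
qed

lemma square_summable_tendsto_zero:
  assumes "square_summable x"
  shows "x \<longlonglongrightarrow> 0"
  using tendsto_real_sqrt[OF summable_LIMSEQ_zero[of "\<lambda>n. (x n)\<^sup>2"]] assms
  by (simp add: square_summable_def tendsto_rabs_zero_iff)

section \<open>Monotonicity\<close>

lemma mem_gra_S_op_iff: "(y, y') \<in> gra S_op \<longleftrightarrow> y \<in> dom_S \<and> y' = S_fun y"
  by (simp add: gra_def S_op_def set_valued_on_def)

lemma inner_S_fun_eq_zero:
  assumes "y \<in> dom_S"
  shows "inner y (S_fun y) = 0"
proof -
  let ?p = "\<lambda>n. \<Sum>i<n. ell2_nth y i"
  have "inner y (S_fun y) = - (?p 0)\<^sup>2 / 2"
  proof (rule inner_differences_midpoints)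
    show "?p \<longlonglongrightarrow> 0" using assms by (simp add: dom_S_def sums_def)
  qed (simp_all add: nth_S_fun assms field_simps)
  then show ?thesis by simp
qed

lemma S_fun_diff:
  assumes "x \<in> dom_S" "y \<in> dom_S"
  shows "S_fun (x - y) = S_fun x - S_fun y"
  using S_fun_add[OF subspace_diff[OF subspace_dom_S assms] assms(2)] by simp

lemma monotone_S_op: "monotone_op S_op"
  using subspace_diff[OF subspace_dom_S]
  by (auto simp: monotone_op_def mem_gra_S_op_iff S_fun_diff[symmetric] inner_S_fun_eq_zero)

section \<open>Differences of consecutive unit vectors\<close>

definition unit_diff :: "nat \<Rightarrow> ell2" where
  "unit_diff m = Abs_ell2 (\<lambda>n. if n = m then 1 else if n = Suc m then - 1 else 0)"

lemma square_summable_finite_support: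
  assumes "finite N" "\<And>n. n \<notin> N \<Longrightarrow> x n = 0"
  shows "square_summable x"
  unfolding square_summable_def using assms by (intro summable_finite[of N]) auto

lemma nth_unit_diff:
  "ell2_nth (unit_diff m) n = (if n = m then 1 else if n = Suc m then - 1 else 0)"
proof -
  have "square_summable (\<lambda>n. if n = m then 1 else if n = Suc m then - 1 else 0)"
    by (rule square_summable_finite_support[of "{m, Suc m}"]) auto
  then show ?thesis by (simp add: unit_diff_def Abs_ell2_inverse)
qed

lemma sum_unit_diff: "(\<Sum>i<n. ell2_nth (unit_diff m) i) = (if n = Suc m then 1 else 0)"
  by (induction n) (auto simp: nth_unit_diff)

lemma unit_diff_in_dom_S: "unit_diff m \<in> dom_S"
proof -
  have "(\<lambda>n. \<Sum>i<n. ell2_nth (unit_diff m) i) \<longlonglongrightarrow> 0"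
    by (rule tendsto_eventually)
       (auto simp: sum_unit_diff eventually_sequentially intro!: exI[of _ "Suc (Suc m)"])
  moreover have "square_summable (\<lambda>n. \<Sum>i\<le>n. ell2_nth (unit_diff m) i)"
    by (rule square_summable_finite_support[of "{m}"])
       (auto simp: sum_unit_diff simp flip: lessThan_Suc_atMost simp del: sum.lessThan_Suc)
  ultimately show ?thesis by (simp add: dom_S_def sums_def)
qed

lemma nth_S_unit_diff:
  "ell2_nth (S_fun (unit_diff m)) n = (if n = m \<or> n = Suc m then 1 / 2 else 0)"
  unfolding nth_S_fun[OF unit_diff_in_dom_S] sum_unit_diff nth_unit_diff by simp

lemma inner_two_support:
  assumes "\<And>n. n \<noteq> m \<Longrightarrow> n \<noteq> Suc m \<Longrightarrow> ell2_nth u n = 0"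
  shows "inner u v = ell2_nth u m * ell2_nth v m + ell2_nth u (Suc m) * ell2_nth v (Suc m)"
  unfolding inner_ell2_def using assms by (subst suminf_finite[of "{m, Suc m}"]) auto

section \<open>Maximality\<close>

lemma related_S_op_recurrence:
  assumes "monotonically_related S_op x x'"
  shows "ell2_nth x' (Suc m) = ell2_nth x' m + (ell2_nth x m + ell2_nth x (Suc m)) / 2"
proof -
  let ?y = "unit_diff m"
  have "inner ?y x' + inner x (S_fun ?y) = 0"
  proof (rule skew_adjoint_relation)
    fix t :: real
    have "(t *\<^sub>R ?y, t *\<^sub>R S_fun ?y) \<in> gra S_op"
      by (simp add: mem_gra_S_op_iff S_fun_scaleR unit_diff_in_dom_S
          subspace_scale[OF subspace_dom_S])
    then show "inner (x - t *\<^sub>R ?y) (x' - t *\<^sub>R S_fun ?y) \<ge> 0"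
      by (rule monotonically_relatedD[OF assms])
  qed (rule inner_S_fun_eq_zero[OF unit_diff_in_dom_S])
  moreover have "inner ?y x' = ell2_nth x' m - ell2_nth x' (Suc m)"
    by (subst inner_two_support[of m]) (auto simp: nth_unit_diff)
  moreover have "inner x (S_fun ?y) = (ell2_nth x m + ell2_nth x (Suc m)) / 2"
    by (subst inner_commute, subst inner_two_support[of m])
       (auto simp: nth_S_unit_diff field_simps)
  ultimately show ?thesis by linarith
qed

lemma related_S_op_imp_in_gra:
  assumes rel: "monotonically_related S_op x x'"
  shows "(x, x') \<in> gra S_op"
proof -
  define p where "p = (\<lambda>n. ell2_nth x' n - ell2_nth x n / 2)"
  have sq: "square_summable p"
    using square_summable_diff[OF square_summable_nth square_summable_scale[OF square_summable_nth],
        of x' "1 / 2" x]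
    by (simp add: p_def)
  then have lim: "p \<longlonglongrightarrow> 0" by (rule square_summable_tendsto_zero)
  have diff: "ell2_nth x n = p (Suc n) - p n" for n
    by (simp add: p_def related_S_op_recurrence[OF rel] field_simps)
  have mid: "ell2_nth x' n = (p n + p (Suc n)) / 2" for n
    by (simp add: p_def related_S_op_recurrence[OF rel] field_simps)
  \<comment> \<open>The constant \<open>p 0\<close> by which \<open>p\<close> could differ from the partial sums of \<open>x\<close> is excluded by
    comparing \<open>(x, x')\<close> with the origin.\<close>
  have "(0, 0) \<in> gra S_op"
    using S_fun_scaleR[of 0 0] subspace_0[OF subspace_dom_S] by (simp add: mem_gra_S_op_iff)
  then have "inner x x' \<ge> 0"
    using monotonically_relatedD[OF rel] by fastforce
  then have "p 0 = 0"
    unfolding inner_differences_midpoints[OF lim diff mid] by simp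
  then have sum_x: "(\<Sum>i<n. ell2_nth x i) = p n" for n
    by (simp add: diff sum_lessThan_telescope)
  have "square_summable (\<lambda>n. p (Suc n))"
    using sq unfolding square_summable_def by (subst summable_Suc_iff)
  then have dom: "x \<in> dom_S"
    using lim by (simp add: dom_S_def sums_def sum_x flip: lessThan_Suc_atMost del: sum.lessThan_Suc)
  have "x' = S_fun x"
    by (rule ell2_eqI) (simp add: nth_S_fun[OF dom] sum_x p_def)
  with dom show ?thesis by (simp add: mem_gra_S_op_iff)
qed

theorem proposition3p5:
  shows "maximal_monotone_op S_op \<and> closed (gra S_op)"
proof -
  have "maximal_monotone_op S_op"
    using monotone_S_op related_S_op_imp_in_gra
    by (auto simp: maximal_monotone_op_iff_related monotone_op_iff_related)
  then show ?thesis by (simp add: closed_gra_maximal_monotone_op)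
qed

end
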